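(* Let $M\in\mathbb{R}^{n\times n}$ be a positive-definite matrix whose condition number satisfies $\kappa(M)\leq\tilde\kappa$, and let $1\le k\le n$. If $k<n$ and $\tilde\kappa>1$, then for every real $r\geq 0$, $$\Pr\left(\left|Y_k(M)-\mathbb{E}[Y_k(M)]\right|\geq r\right)\leq 3\exp\left(-\frac{r}{\log\tilde\kappa}\sqrt{\frac{n}{k(n-k)}}\right).$$ Furthermore, the variance of $Y_k(M)$ satisfies $$\operatorname{var}(Y_k(M))\leq 6\left(\frac{k(n-k)}{n}\right)(\log\tilde\kappa)^2.$$
   Context: Positive-definite matrices are real symmetric with all eigenvalues positive. For a positive-definite $n\times n$ matrix $M$ with eigenvalues $\lambda_1(M)\geq\cdots\geq\lambda_n(M)>0$, the condition number is $\kappa(M)=\lambda_1(M)/\lambda_n(M)$. For a $k$-element index set $I\subseteq\{1,\ldots,n\}$, $M_I:=[M_{i,j}]_{i,j\in I}$ is the corresponding principal $k\times k$ submatrix of $M$. The random matrix $A_k(M)$ is $M_I$ with $I$ chosen uniformly at random among the $\binom{n}{k}$ $k$-element subsets of $\{1,\ldots,n\}$, and $Y_k(M):=\log(\det A_k(M))$. Here $\log$ is the logarithm to a fixed base greater than $1$, the same one throughout. *)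

theory Defs
  imports
    "HOL-Probability.Probability"
    "Jordan_Normal_Form.DL_Submatrix"
    "Jordan_Normal_Form.Spectral_Radius"
begin

text \<open>
  Matrices are those of the type \<^typ>\<open>real mat\<close>, whose rows and columns are indexed from 0;
  accordingly index sets are subsets of \<open>{..<n}\<close>. Both the multivariate analysis library and the
  matrix library provide a determinant; the one used below is \<^const>\<open>Determinant.det\<close>.
\<close>

text \<open>
  \<^const>\<open>eigenvalue\<close> speaks about real eigenvalues only, but a real symmetric matrix has no others.
\<close>

definition pos_def_mat :: "nat \<Rightarrow> real mat \<Rightarrow> bool" where
  "pos_def_mat n M \<longleftrightarrow>
     M \<in> carrier_mat n n \<and> transpose_mat M = M \<and> (\<forall>l. eigenvalue M l \<longrightarrow> 0 < l)"

text \<open>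
  Only meaningful for positive-definite matrices of dimension at least 1: then the spectrum is
  finite and nonempty, and its maximum and minimum are the first and last of the decreasingly
  ordered eigenvalues.
\<close>

definition cond_number :: "real mat \<Rightarrow> real" where
  "cond_number M = Max (spectrum M) / Min (spectrum M)"

definition principal_submatrix :: "real mat \<Rightarrow> nat set \<Rightarrow> real mat" where
  "principal_submatrix M I = submatrix M I I"

definition random_principal_submatrix :: "nat \<Rightarrow> real mat \<Rightarrow> real mat pmf" where
  "random_principal_submatrix k M =
     map_pmf (principal_submatrix M) (pmf_of_set {I. I \<subseteq> {..<dim_row M} \<and> card I = k})"

definition log_det :: "real \<Rightarrow> real mat \<Rightarrow> real" where
  "log_det b A = log b (Determinant.det A)"

end

theory Submission
  imports Defs
begin

text \<open>
  If \<open>M\<close> lies between \<open>l I\<close> and \<open>h I\<close>, so does every principal submatrix, and Cramer's rule shows that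
  adjoining one index to \<open>I\<close> multiplies \<open>det M\<^sub>I\<close> by a factor in \<open>[l, h]\<close>. Hence exchanging one
  element of \<open>I\<close> changes \<open>log (det M\<^sub>I)\<close> by at most \<open>L = log \<kappa>\<close>. For functions on \<open>k\<close>-subsets with
  this property, drawing the elements one by one and applying Hoeffding's lemma at every step bounds the
  moment generating function of the deviation from the mean by \<open>exp (s\<^sup>2 k L\<^sup>2 / 8)\<close>. Passing to
  complements improves \<open>k\<close> to \<open>min k (n - k) \<le> 2 k (n - k) / n\<close>. So the deviation is even
  subgaussian: its tail is at most \<open>2 exp (- t\<^sup>2) \<le> 3 exp (- t)\<close> with
  \<open>t = (r / L) sqrt (n / (k (n - k)))\<close>.
\<close>

subsection \<open>Eigenvalues and quadratic forms\<close>

text \<open>Vectors are plain functions, so that restricting, reindexing and extending by zero are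
  mere operations on sums.\<close>

definition bform :: "(nat \<Rightarrow> nat \<Rightarrow> real) \<Rightarrow> nat set \<Rightarrow> (nat \<Rightarrow> real) \<Rightarrow> (nat \<Rightarrow> real) \<Rightarrow> real" where
  "bform a S x y = (\<Sum>i\<in>S. \<Sum>j\<in>S. a i j * x i * y j)"

lemma bform_commute:
  assumes "\<And>i j. i \<in> S \<Longrightarrow> j \<in> S \<Longrightarrow> a i j = a j i"
  shows "bform a S x y = bform a S y x"
  unfolding bform_def
  by (subst sum.swap) (intro sum.cong refl, simp add: assms mult_ac)

lemma bform_row: "bform a S x y = (\<Sum>i\<in>S. x i * (\<Sum>j\<in>S. a i j * y j))"
  unfolding bform_def by (simp add: sum_distrib_left mult_ac)

lemma bform_diff_scaled:
  assumes "\<And>i j. i \<in> S \<Longrightarrow> j \<in> S \<Longrightarrow> a i j = a j i"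
  shows "bform a S (\<lambda>i. x i - s * y i) (\<lambda>i. x i - s * y i) =
         bform a S x x - 2 * s * bform a S x y + s\<^sup>2 * bform a S y y"
proof -
  have "bform a S (\<lambda>i. x i - s * y i) (\<lambda>i. x i - s * y i) =
        bform a S x x - s * bform a S x y - s * bform a S y x + s\<^sup>2 * bform a S y y"
  proof -
    have "bform a S (\<lambda>i. x i - s * y i) (\<lambda>i. x i - s * y i) =
          (\<Sum>i\<in>S. \<Sum>j\<in>S. a i j * x i * x j - s * (a i j * x i * y j) - s * (a i j * y i * x j)
                       + s\<^sup>2 * (a i j * y i * y j))"
      unfolding bform_def
      by (intro sum.cong refl) (simp add: algebra_simps power2_eq_square)
    thus ?thesis
      unfolding bform_def by (simp only: sum.distrib sum_subtractf sum_distrib_left)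
  qed
  thus ?thesis
    using bform_commute[OF assms, where x = x and y = y] by simp
qed

text \<open>Each product \<open>\<bar>x i\<bar> * \<bar>x j\<bar>\<close> is at most the squared
  norm, by \<open>2uv \<le> u^2 + v^2\<close>. The crude constant suffices: it serves only to show
  that a form is bounded on the unit sphere.\<close>

lemma bform_le:
  assumes "finite S"
  shows "\<bar>bform a S x x\<bar> \<le> (\<Sum>i\<in>S. \<Sum>j\<in>S. \<bar>a i j\<bar>) * (\<Sum>i\<in>S. (x i)\<^sup>2)"
proof -
  let ?N = "\<Sum>i\<in>S. (x i)\<^sup>2"
  have "\<bar>a i j * x i * x j\<bar> \<le> \<bar>a i j\<bar> * ?N" if "i \<in> S" "j \<in> S" for i j
  proof -
    have "0 \<le> (\<bar>x i\<bar> - \<bar>x j\<bar>)\<^sup>2" by simp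
    hence "2 * (\<bar>x i\<bar> * \<bar>x j\<bar>) \<le> (x i)\<^sup>2 + (x j)\<^sup>2"
      by (simp add: power2_diff)
    also have "\<dots> \<le> ?N + ?N"
      using that assms by (intro add_mono member_le_sum) auto
    finally have "\<bar>x i\<bar> * \<bar>x j\<bar> \<le> ?N" by simp
    thus ?thesis
      by (metis abs_ge_zero abs_mult mult.assoc mult_left_mono)
  qed
  hence "\<bar>bform a S x x\<bar> \<le> (\<Sum>i\<in>S. \<Sum>j\<in>S. \<bar>a i j\<bar> * ?N)"
    unfolding bform_def by (intro order_trans[OF sum_abs] sum_mono)
  thus ?thesis by (simp add: sum_distrib_right)
qed

text \<open>Cramer's rule in coordinates: column \<open>p\<close> of the adjugate is mapped by
  \<open>A\<close> to \<open>det A\<close> times the \<open>p\<close>-th unit vector.\<close>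

lemma mult_adj_mat_index:
  fixes A :: "real mat"
  assumes "A \<in> carrier_mat n n" "i < n" "p < n"
  shows "(\<Sum>j<n. A $$ (i,j) * adj_mat A $$ (j,p)) = (if i = p then Determinant.det A else 0)"
proof -
  have "(A * adj_mat A) $$ (i,p) = (\<Sum>j<n. A $$ (i,j) * adj_mat A $$ (j,p))"
    using assms adj_mat(1)[OF assms(1)]
    by (auto simp: scalar_prod_def atLeast0LessThan intro!: sum.cong)
  thus ?thesis
    using assms adj_mat(2)[OF assms(1)] by (cases "i = p") auto
qed

lemma sum_unit_squares:
  assumes "finite S" "p \<in> S"
  shows "(\<Sum>i\<in>S. (of_bool (i = p) :: real)\<^sup>2) = 1"
proof -
  have "(\<Sum>i\<in>S. (of_bool (i = p) :: real)\<^sup>2) = (\<Sum>i\<in>S. if i = p then 1 else 0)"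
    by (intro sum.cong refl) auto
  thus ?thesis using assms by simp
qed

lemma bform_unit:
  assumes "finite S" "p \<in> S"
  shows "bform a S (\<lambda>i. of_bool (i = p)) (\<lambda>i. of_bool (i = p)) = a p p"
proof -
  have "bform a S (\<lambda>i. of_bool (i = p)) (\<lambda>i. of_bool (i = p)) =
        (\<Sum>i\<in>S. if i = p then \<Sum>j\<in>S. if j = p then a p p else 0 else 0)"
    unfolding bform_def by (intro sum.cong refl) (auto intro!: sum.cong)
  thus ?thesis using assms by simp
qed

text \<open>
  The largest \<open>t\<close> such that \<open>A - t I\<close> is positive semidefinite is an eigenvalue: if \<open>A - t I\<close> were
  invertible, the boundedness of the inverse would leave room for a larger \<open>t\<close>.
\<close>
lemma exists_eigenvalue_le_bform:
  fixes A :: "real mat"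
  assumes A: "A \<in> carrier_mat n n" and n: "0 < n"
    and sym: "\<And>i j. i < n \<Longrightarrow> j < n \<Longrightarrow> A $$ (i,j) = A $$ (j,i)"
  shows "\<exists>l. eigenvalue A l \<and>
           (\<forall>x. l * (\<Sum>i<n. (x i)\<^sup>2) \<le> bform (\<lambda>i j. A $$ (i,j)) {..<n} x x)"
proof -
  define Q where "Q = (\<lambda>x. bform (\<lambda>i j. A $$ (i,j)) {..<n} x x)"
  define N where "N = (\<lambda>x::nat \<Rightarrow> real. \<Sum>i<n. (x i)\<^sup>2)"
  define T where "T = {t. \<forall>x. t * N x \<le> Q x}"
  have N0: "N x \<ge> 0" for x by (simp add: N_def sum_nonneg)
  have "- (\<Sum>i<n. \<Sum>j<n. \<bar>A $$ (i,j)\<bar>) * N x \<le> Q x" for x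
    using bform_le[of "{..<n}" "\<lambda>i j. A $$ (i,j)" x] unfolding Q_def N_def by simp
  hence ne: "T \<noteq> {}" unfolding T_def by blast
  have ub: "t \<le> A $$ (0,0)" if "t \<in> T" for t
  proof -
    have "t * N (\<lambda>i. of_bool (i = 0)) \<le> Q (\<lambda>i. of_bool (i = 0))"
      using that by (simp add: T_def)
    thus ?thesis
      using n unfolding N_def Q_def
      using sum_unit_squares[of "{..<n}" 0] bform_unit[of "{..<n}" 0] by simp
  qed
  have bdd: "bdd_above T" by (rule bdd_aboveI) (rule ub)
  define t where "t = Sup T"
  \<comment> \<open>The supremum itself lies in \<open>T\<close>, because for fixed \<open>x\<close>
    the condition reads \<open>t \<le> Q x / N x\<close>. If \<open>N x = 0\<close>, any member of
    \<open>T\<close> yields \<open>0 \<le> Q x\<close>.\<close>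
  have tQ: "t * N x \<le> Q x" for x
  proof (cases "N x = 0")
    case True
    obtain s where "s \<in> T" using ne by blast
    hence "s * N x \<le> Q x" by (simp add: T_def)
    thus ?thesis using True by simp
  next
    case False
    with N0[of x] have pos: "N x > 0" by simp
    have "t \<le> Q x / N x"
      unfolding t_def using ne pos by (intro cSup_least) (auto simp: T_def field_simps)
    thus ?thesis using pos by (simp add: field_simps)
  qed
  have "eigenvalue A t"
  proof (rule ccontr)
    assume not_ev: "\<not> eigenvalue A t"
    define B where "B = char_matrix A t"
    define d where "d = Determinant.det B"
    have B: "B \<in> carrier_mat n n" using A by (simp add: B_def)
    have d: "d \<noteq> 0" using not_ev eigenvalue_det[OF A] by (simp add: d_def B_def)
    have B_ix: "B $$ (i,j) = A $$ (i,j) - t * of_bool (i = j)" if "i < n" "j < n" for i j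
      using that A by (simp add: B_def char_matrix_def)
    have symB: "B $$ (i,j) = B $$ (j,i)" if "i < n" "j < n" for i j
      using that sym by (auto simp: B_ix)
    define b where "b = bform (\<lambda>i j. B $$ (i,j)) {..<n}"
    have bQ: "b x x = Q x - t * N x" for x
    proof -
      have "b x x = (\<Sum>i<n. \<Sum>j<n. A $$ (i,j) * x i * x j - (if i = j then t * (x i)\<^sup>2 else 0))"
        unfolding b_def bform_def
        by (intro sum.cong refl) (auto simp: B_ix algebra_simps power2_eq_square)
      also have "\<dots> = Q x - t * N x"
        by (simp add: Q_def N_def bform_def sum_subtractf sum_distrib_left)
      finally show ?thesis .
    qed
    \<comment> \<open>\<open>W\<close> is the inverse of \<open>B = A - t I\<close>, and
      \<open>C\<close> is a positive bound for its quadratic form on the unit sphere; the summand 1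
      keeps \<open>C\<close> away from 0.\<close>
    define W where "W = (\<lambda>i j. adj_mat B $$ (i,j) / d)"
    define C where "C = 1 + (\<Sum>i<n. \<Sum>j<n. \<bar>W i j\<bar>)"
    have C: "C > 0" unfolding C_def by (intro add_pos_nonneg sum_nonneg) auto
    have "(t + 1 / C) * N x \<le> Q x" for x
    proof -
      define y where "y = (\<lambda>j. \<Sum>p<n. W j p * x p)"
      have By: "(\<Sum>j<n. B $$ (i,j) * y j) = x i" if i: "i < n" for i
      proof -
        have "(\<Sum>j<n. B $$ (i,j) * y j) = (\<Sum>p<n. \<Sum>j<n. B $$ (i,j) * W j p * x p)"
          unfolding y_def sum_distrib_left by (subst sum.swap) (simp add: mult_ac)
        also have "\<dots> = (\<Sum>p<n. (\<Sum>j<n. B $$ (i,j) * adj_mat B $$ (j,p)) / d * x p)"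
          unfolding W_def by (simp add: sum_distrib_right sum_divide_distrib)
        also have "\<dots> = (\<Sum>p<n. if p = i then x i else 0)"
          using mult_adj_mat_index[OF B i] d by (intro sum.cong refl) (auto simp: d_def)
        also have "\<dots> = x i" using i by simp
        finally show ?thesis .
      qed
      have bxy: "b x y = N x"
        unfolding b_def bform_row N_def by (simp add: By power2_eq_square)
      have "b y y = (\<Sum>i<n. y i * x i)"
        unfolding b_def bform_row by (simp add: By)
      also have "\<dots> = bform W {..<n} x x"
        unfolding y_def bform_def by (simp add: sum_distrib_left sum_distrib_right mult_ac)
      also have "\<dots> \<le> (\<Sum>i<n. \<Sum>j<n. \<bar>W i j\<bar>) * N x"
        using bform_le[of "{..<n}" W x] by (simp add: N_def)
      also have "\<dots> \<le> C * N x"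
        using N0[of x] by (intro mult_right_mono) (auto simp: C_def)
      finally have byy: "b y y \<le> C * N x" .
      \<comment> \<open>As \<open>y\<close> is the preimage of \<open>x\<close> under
        \<open>B\<close>, \<open>b x y = N x\<close> and \<open>b y y \<le> C * N x\<close>. The
        factor \<open>1/C\<close> minimises \<open>- 2 * s + s^2 * C\<close>, which leaves the gain
        \<open>N x / C\<close>.\<close>
      have "0 \<le> b (\<lambda>i. x i - (1/C) * y i) (\<lambda>i. x i - (1/C) * y i)"
        using tQ bQ by simp
      also have "\<dots> = b x x - 2 * (1/C) * b x y + (1/C)\<^sup>2 * b y y"
        unfolding b_def by (rule bform_diff_scaled) (auto intro: symB)
      also have "\<dots> \<le> b x x - 2 * (1/C) * N x + (1/C)\<^sup>2 * (C * N x)"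
        using byy unfolding bxy by (intro add_left_mono mult_left_mono) auto
      also have "\<dots> = Q x - (t + 1 / C) * N x"
        using C unfolding bQ by (simp add: field_simps power2_eq_square)
      finally show ?thesis by simp
    qed
    hence "t + 1 / C \<in> T" by (simp add: T_def)
    hence "t + 1 / C \<le> t" unfolding t_def by (intro cSup_upper bdd)
    thus False using C by (simp add: field_simps)
  qed
  thus ?thesis using tQ unfolding Q_def N_def by blast
qed

text \<open>This is the previous lemma applied to \<open>- A\<close>, with the signs of the form and
  of the eigenvalue reversed.\<close>

lemma exists_eigenvalue_ge_bform:
  fixes A :: "real mat"
  assumes A: "A \<in> carrier_mat n n" and n: "0 < n"
    and sym: "\<And>i j. i < n \<Longrightarrow> j < n \<Longrightarrow> A $$ (i,j) = A $$ (j,i)"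
  shows "\<exists>l. eigenvalue A l \<and>
           (\<forall>x. bform (\<lambda>i j. A $$ (i,j)) {..<n} x x \<le> l * (\<Sum>i<n. (x i)\<^sup>2))"
proof -
  have mA: "- A \<in> carrier_mat n n" using A by simp
  have "(- A) $$ (i,j) = (- A) $$ (j,i)" if "i < n" "j < n" for i j
    using that sym A by simp
  then obtain l where ev: "eigenvalue (- A) l"
    and l: "\<And>x. l * (\<Sum>i<n. (x i)\<^sup>2) \<le> bform (\<lambda>i j. (- A) $$ (i,j)) {..<n} x x"
    using exists_eigenvalue_le_bform[OF mA n] by blast
  have "bform (\<lambda>i j. (- A) $$ (i,j)) {..<n} x x = - bform (\<lambda>i j. A $$ (i,j)) {..<n} x x" for x
    using A unfolding bform_def by (simp add: sum_negf)
  hence "bform (\<lambda>i j. A $$ (i,j)) {..<n} x x \<le> - l * (\<Sum>i<n. (x i)\<^sup>2)" for x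
    using l[of x] by simp
  moreover have "eigenvalue A (- l)"
  proof -
    have "char_matrix (- A) l = (- 1) \<cdot>\<^sub>m char_matrix A (- l)"
      using A by (intro eq_matI) (auto simp: char_matrix_def)
    moreover have "Determinant.det (char_matrix (- A) l) = 0"
      using ev eigenvalue_det[OF mA] by simp
    ultimately show ?thesis
      using eigenvalue_det[OF A] by (simp add: det_smult)
  qed
  ultimately show ?thesis by blast
qed

text \<open>Let \<open>w\<close> be column \<open>p\<close> of the adjugate, \<open>d\<close> the
  determinant and \<open>e\<close> the cofactor. Then \<open>A w\<close> is \<open>d\<close> times
  the unit vector \<open>u\<close> at \<open>p\<close>, and \<open>w p = e\<close>, so the form
  takes the value \<open>d * e\<close> at \<open>w\<close>. The lower bound compares this with
  \<open>lo * e^2\<close>; the upper bound is Cauchy-Schwarz for the form, applied to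
  \<open>w\<close> and \<open>u\<close>.\<close>

lemma cofactor_det_bounds:
  fixes A :: "real mat"
  assumes A: "A \<in> carrier_mat m m" and p: "p < m"
    and sym: "\<And>i j. i < m \<Longrightarrow> j < m \<Longrightarrow> A $$ (i,j) = A $$ (j,i)"
    and lo: "\<And>x. lo * (\<Sum>i<m. (x i)\<^sup>2) \<le> bform (\<lambda>i j. A $$ (i,j)) {..<m} x x"
    and hi: "\<And>x. bform (\<lambda>i j. A $$ (i,j)) {..<m} x x \<le> hi * (\<Sum>i<m. (x i)\<^sup>2)"
    and pos: "0 < lo" "0 < cofactor A p p"
  shows "lo * cofactor A p p \<le> Determinant.det A \<and> Determinant.det A \<le> hi * cofactor A p p"
proof
  define d where "d = Determinant.det A"
  define e where "e = cofactor A p p"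
  define w where "w = (\<lambda>j. adj_mat A $$ (j,p))"
  define u :: "nat \<Rightarrow> real" where "u = (\<lambda>i. of_bool (i = p))"
  define q where "q = bform (\<lambda>i j. A $$ (i,j)) {..<m}"
  have e: "e > 0" using pos by (simp add: e_def)
  have wp: "w p = e" using A p by (simp add: w_def e_def adj_mat_def)
  have Aw: "(\<Sum>j<m. A $$ (i,j) * w j) = (if i = p then d else 0)" if "i < m" for i
    using mult_adj_mat_index[OF A that p] by (simp add: w_def d_def)
  have qxw: "q x w = d * x p" for x
  proof -
    have "q x w = (\<Sum>i<m. if i = p then d * x p else 0)"
      unfolding q_def bform_row by (intro sum.cong refl) (simp add: Aw)
    thus ?thesis using p by simp
  qed
  have "lo * e\<^sup>2 \<le> lo * (\<Sum>i<m. (w i)\<^sup>2)"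
    using pos p unfolding wp[symmetric] by (intro mult_left_mono member_le_sum) auto
  also have "\<dots> \<le> d * e"
    using lo[of w] qxw[of w] by (simp add: q_def wp)
  finally have "lo * e * e \<le> d * e" by (simp add: power2_eq_square mult_ac)
  hence le: "lo * e \<le> d" using e by simp
  thus "lo * cofactor A p p \<le> Determinant.det A" by (simp add: d_def e_def)
  have N_u: "(\<Sum>i<m. (u i)\<^sup>2) = 1"
    unfolding u_def using p by (intro sum_unit_squares) auto
  have quu: "lo \<le> q u u" "q u u \<le> hi"
    using lo[of u] hi[of u] by (simp_all add: N_u q_def)
  hence hi_pos: "hi > 0" using pos by simp
  have d: "d > 0" using le e pos by (smt (verit) mult_pos_pos)
  have qwu: "q w u = d"
    using qxw[of u] bform_commute[of "{..<m}" "\<lambda>i j. A $$ (i,j)" w u] sym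
    by (simp add: q_def u_def)
  \<comment> \<open>Cauchy-Schwarz is carried out by hand: subtracting \<open>d/hi\<close> times
    \<open>u\<close> from \<open>w\<close> is optimal when \<open>q u u\<close> is replaced by its
    bound \<open>hi\<close>.\<close>
  have "0 \<le> lo * (\<Sum>i<m. (w i - (d/hi) * u i)\<^sup>2)"
    using pos by (intro mult_nonneg_nonneg sum_nonneg) auto
  also have "\<dots> \<le> q (\<lambda>i. w i - (d/hi) * u i) (\<lambda>i. w i - (d/hi) * u i)"
    unfolding q_def by (rule lo)
  also have "\<dots> = q w w - 2 * (d/hi) * q w u + (d/hi)\<^sup>2 * q u u"
    unfolding q_def by (rule bform_diff_scaled) (auto intro: sym)
  also have "\<dots> \<le> d * e - 2 * (d/hi) * d + (d/hi)\<^sup>2 * hi"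
    using quu unfolding qwu qxw wp by (intro add_left_mono mult_left_mono) auto
  also have "\<dots> = d * (e - d / hi)"
    using hi_pos by (simp add: field_simps power2_eq_square)
  finally have "d / hi \<le> e" using d by (simp add: zero_le_mult_iff)
  thus "Determinant.det A \<le> hi * cofactor A p p"
    using hi_pos by (simp add: field_simps d_def e_def)
qed

section \<open>Principal submatrices and ratios of their determinants\<close>

text \<open>\<open>pick I q\<close> is the \<open>q\<close>-th smallest element, counted from 0. An
  element is determined by the number of elements below it, and removing \<open>pick I p\<close>
  lowers this number by one exactly for the elements above it.\<close>

lemma pick_remove:
  assumes "finite I" "p < card I" "q < card I - 1"
  shows "pick (I - {pick I p}) q = pick I (if q < p then q else Suc q)"
proof -
  define r where "r = (if q < p then q else Suc q)"
  have r: "r < card I" "r \<noteq> p" using assms by (auto simp: r_def)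
  define x where "x = pick I r"
  have xI: "x \<in> I" using r pick_in_set_le by (simp add: x_def)
  have less: "pick I p < x \<longleftrightarrow> p < r"
    using r assms(2) pick_mono_le[of r I p] pick_mono_le[of p I r] unfolding x_def
    by (metis linorder_neqE_nat order_less_asym)
  have ne: "x \<noteq> pick I p"
    using r assms(2) pick_mono_le[of r I p] pick_mono_le[of p I r] unfolding x_def
    by (metis linorder_neqE_nat order_less_irrefl)
  have "{a \<in> I - {pick I p}. a < x} = {a \<in> I. a < x} - {pick I p}" by auto
  moreover have "card {a \<in> I. a < x} = r" using card_pick_le r by (simp add: x_def)
  moreover have "pick I p \<in> I" using pick_in_set_le assms by simp
  ultimately have "card {a \<in> I - {pick I p}. a < x} = r - of_bool (p < r)"
    using assms(1) less by (cases "p < r") (auto simp: card_Diff_singleton_if)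
  also have "\<dots> = q" by (auto simp: r_def)
  finally have "pick (I - {pick I p}) q = x"
    using pick_card_in_set[of x "I - {pick I p}"] xI ne by simp
  thus ?thesis by (simp add: x_def r_def)
qed

lemma bij_betw_pick:
  assumes "finite I"
  shows "bij_betw (pick I) {..<card I} I"
proof -
  have "inj_on (pick I) {..<card I}"
    by (rule inj_onI) (metis lessThan_iff linorder_neqE_nat order_less_irrefl pick_mono_le)
  moreover have "pick I ` {..<card I} \<subseteq> I" using pick_in_set_le by auto
  ultimately show ?thesis
    using assms by (simp add: bij_betw_def card_image card_subset_eq)
qed

lemma principal_submatrix_carrier:
  assumes "M \<in> carrier_mat n n" "I \<subseteq> {..<n}"
  shows "principal_submatrix M I \<in> carrier_mat (card I) (card I)"
proof -
  have "{i. i < n \<and> i \<in> I} = I" using assms(2) by auto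
  thus ?thesis using assms by (auto simp: principal_submatrix_def dim_submatrix)
qed

lemma principal_submatrix_index:
  assumes "M \<in> carrier_mat n n" "I \<subseteq> {..<n}" "i < card I" "j < card I"
  shows "principal_submatrix M I $$ (i,j) = M $$ (pick I i, pick I j)"
proof -
  have "{i. i < n \<and> i \<in> I} = I" using assms(2) by auto
  thus ?thesis using assms by (auto simp: principal_submatrix_def submatrix_index)
qed

text \<open>This makes the diagonal cofactors of a principal submatrix principal minors of
  \<open>M\<close> again, so that index sets can be built up one element at a time.\<close>

lemma mat_delete_principal_submatrix:
  assumes M: "M \<in> carrier_mat n n" and I: "I \<subseteq> {..<n}" and p: "p < card I"
  shows "mat_delete (principal_submatrix M I) p p = principal_submatrix M (I - {pick I p})"
proof -
  have fin: "finite I" using I finite_subset by blast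
  have pI: "pick I p \<in> I" using p pick_in_set_le by simp
  have card: "card (I - {pick I p}) = card I - 1" using fin pI by simp
  have I': "I - {pick I p} \<subseteq> {..<n}" using I by auto
  note c1 = principal_submatrix_carrier[OF M I]
  note c2 = principal_submatrix_carrier[OF M I', unfolded card]
  show ?thesis
    using c1 c2 p fin
    by (intro eq_matI)
       (auto simp: mat_delete_def principal_submatrix_index[OF M I]
          principal_submatrix_index[OF M I'] card pick_remove)
qed

text \<open>Transporting \<open>x\<close> to \<open>I\<close> along \<open>pick I\<close> and
  extending by zero changes neither form nor norm. Hence bounds on the form of \<open>M\<close> pass
  to all principal submatrices.\<close>

lemma bform_principal_submatrix:
  assumes M: "M \<in> carrier_mat n n" and I: "I \<subseteq> {..<n}"
  shows "\<exists>z. bform (\<lambda>i j. principal_submatrix M I $$ (i,j)) {..<card I} x x =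
               bform (\<lambda>i j. M $$ (i,j)) {..<n} z z
             \<and> (\<Sum>i<card I. (x i)\<^sup>2) = (\<Sum>i<n. (z i)\<^sup>2)"
proof -
  have fin: "finite I" using I finite_subset by blast
  have bij: "bij_betw (pick I) {..<card I} I" by (rule bij_betw_pick[OF fin])
  define z where "z = (\<lambda>a. if a \<in> I then x (inv_into {..<card I} (pick I) a) else 0)"
  have z: "z (pick I i) = x i" if "i < card I" for i
    using that bij pick_in_set_le[OF that]
    by (simp add: z_def bij_betw_def)
  have "bform (\<lambda>i j. principal_submatrix M I $$ (i,j)) {..<card I} x x =
        (\<Sum>i<card I. \<Sum>j<card I. M $$ (pick I i, pick I j) * z (pick I i) * z (pick I j))"
    unfolding bform_def
    by (intro sum.cong refl) (simp add: principal_submatrix_index[OF M I] z)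
  also have "\<dots> = (\<Sum>i<card I. \<Sum>j\<in>I. M $$ (pick I i, j) * z (pick I i) * z j)"
    by (intro sum.cong refl sum.reindex_bij_betw[OF bij])
  also have "\<dots> = (\<Sum>i\<in>I. \<Sum>j\<in>I. M $$ (i, j) * z i * z j)"
    by (rule sum.reindex_bij_betw[OF bij])
  also have "\<dots> = (\<Sum>i\<in>I. \<Sum>j<n. M $$ (i, j) * z i * z j)"
    using I by (intro sum.cong refl sum.mono_neutral_left) (auto simp: z_def)
  also have "\<dots> = (\<Sum>i<n. \<Sum>j<n. M $$ (i, j) * z i * z j)"
    using I by (intro sum.mono_neutral_left) (auto simp: z_def)
  finally have 1: "bform (\<lambda>i j. principal_submatrix M I $$ (i,j)) {..<card I} x x =
               bform (\<lambda>i j. M $$ (i,j)) {..<n} z z" by (simp add: bform_def)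
  have "(\<Sum>i<card I. (x i)\<^sup>2) = (\<Sum>i<card I. (z (pick I i))\<^sup>2)"
    by (intro sum.cong refl) (simp add: z)
  also have "\<dots> = (\<Sum>i\<in>I. (z i)\<^sup>2)" by (rule sum.reindex_bij_betw[OF bij])
  also have "\<dots> = (\<Sum>i<n. (z i)\<^sup>2)"
    using I by (intro sum.mono_neutral_left) (auto simp: z_def)
  finally show ?thesis using 1 by blast
qed

lemma principal_minor_bounds:
  fixes M :: "real mat"
  assumes M: "M \<in> carrier_mat n n"
    and sym: "\<And>i j. i < n \<Longrightarrow> j < n \<Longrightarrow> M $$ (i,j) = M $$ (j,i)"
    and lo: "\<And>x. lo * (\<Sum>i<n. (x i)\<^sup>2) \<le> bform (\<lambda>i j. M $$ (i,j)) {..<n} x x"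
    and hi: "\<And>x. bform (\<lambda>i j. M $$ (i,j)) {..<n} x x \<le> hi * (\<Sum>i<n. (x i)\<^sup>2)"
    and lo_pos: "0 < lo"
    and K: "insert a K \<subseteq> {..<n}" "a \<notin> K"
    and pos: "0 < Determinant.det (principal_submatrix M K)"
  shows "lo * Determinant.det (principal_submatrix M K)
           \<le> Determinant.det (principal_submatrix M (insert a K))"
    and "Determinant.det (principal_submatrix M (insert a K))
           \<le> hi * Determinant.det (principal_submatrix M K)"
proof -
  let ?I = "insert a K"
  let ?A = "principal_submatrix M ?I"
  have fin: "finite ?I" by (rule finite_subset[OF K(1)]) simp
  have "a \<in> pick ?I ` {..<card ?I}"
    unfolding bij_betw_imp_surj_on[OF bij_betw_pick[OF fin]] by (rule insertI1)
  then obtain p where "a = pick ?I p" "p \<in> {..<card ?I}" by (rule imageE)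
  hence p: "p < card ?I" "pick ?I p = a" by (simp_all only: lessThan_iff)
  \<comment> \<open>The sign of a diagonal cofactor is \<open>(-1)^(p+p) = 1\<close>.\<close>
  have cof: "cofactor ?A p p = Determinant.det (principal_submatrix M K)"
    using mat_delete_principal_submatrix[OF M K(1) p(1)] p(2) K(2)
    by (simp add: cofactor_def)
  have pick_lt: "pick ?I i < n" if "i < card ?I" for i
    using subsetD[OF K(1) pick_in_set_le[OF that]] by (simp only: lessThan_iff)
  have "lo * cofactor ?A p p \<le> Determinant.det ?A \<and> Determinant.det ?A \<le> hi * cofactor ?A p p"
  proof (rule cofactor_det_bounds[OF principal_submatrix_carrier[OF M K(1)] p(1)])
    show "?A $$ (i,j) = ?A $$ (j,i)" if "i < card ?I" "j < card ?I" for i j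
      using sym[OF pick_lt pick_lt, OF that] that by (simp only: principal_submatrix_index[OF M K(1)])
    show "lo * (\<Sum>i<card ?I. (x i)\<^sup>2) \<le> bform (\<lambda>i j. ?A $$ (i,j)) {..<card ?I} x x" for x
      using bform_principal_submatrix[OF M K(1), of x] lo by metis
    show "bform (\<lambda>i j. ?A $$ (i,j)) {..<card ?I} x x \<le> hi * (\<Sum>i<card ?I. (x i)\<^sup>2)" for x
      using bform_principal_submatrix[OF M K(1), of x] hi by metis
  qed (use lo_pos pos cof in auto)
  thus "lo * Determinant.det (principal_submatrix M K) \<le> Determinant.det ?A"
    and "Determinant.det ?A \<le> hi * Determinant.det (principal_submatrix M K)"
    by (simp_all add: cof)
qed

text \<open>Both determinants lie between \<open>l\<close> and \<open>h\<close> times the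
  determinant for the common part \<open>K\<close>, so their ratio is at most
  \<open>h / l\<close>.\<close>

lemma log_det_swap_le:
  fixes M :: "real mat"
  assumes b: "1 < b" and pd: "pos_def_mat n M" and cond: "cond_number M \<le> \<kappa>"
    and K: "insert i K \<subseteq> {..<n}" "insert j K \<subseteq> {..<n}" "i \<notin> K" "j \<notin> K"
  shows "\<bar>log_det b (principal_submatrix M (insert i K)) -
          log_det b (principal_submatrix M (insert j K))\<bar> \<le> log b \<kappa>"
proof -
  have M: "M \<in> carrier_mat n n" and tr: "transpose_mat M = M"
    and ev_pos: "\<And>l. eigenvalue M l \<Longrightarrow> 0 < l"
    using pd by (auto simp: pos_def_mat_def)
  have n: "0 < n" using K by auto
  have sym: "M $$ (i,j) = M $$ (j,i)" if "i < n" "j < n" for i j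
    using that M tr by (metis carrier_matD index_transpose_mat(1))
  have fin: "finite (spectrum M)" by (rule card_finite_spectrum(1)[OF M])
  obtain l where l: "eigenvalue M l"
    "\<And>x. l * (\<Sum>i<n. (x i)\<^sup>2) \<le> bform (\<lambda>i j. M $$ (i,j)) {..<n} x x"
    using exists_eigenvalue_le_bform[OF M n sym] by blast
  obtain h where h: "eigenvalue M h"
    "\<And>x. bform (\<lambda>i j. M $$ (i,j)) {..<n} x x \<le> h * (\<Sum>i<n. (x i)\<^sup>2)"
    using exists_eigenvalue_ge_bform[OF M n sym] by blast
  have l_pos: "0 < l" and h_pos: "0 < h" using l(1) h(1) ev_pos by auto
  have ne: "spectrum M \<noteq> {}" using l(1) by (auto simp: spectrum_def)
  have "0 < Min (spectrum M)"
    using fin ne ev_pos by (simp add: spectrum_def)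
  moreover have "Min (spectrum M) \<le> l" "h \<le> Max (spectrum M)"
    using l(1) h(1) fin by (auto simp: spectrum_def)
  \<comment> \<open>That \<open>l\<close> and \<open>h\<close> belong to the spectrum is enough
    here: their quotient cannot exceed that of its maximum and minimum.\<close>
  ultimately have "h / l \<le> cond_number M"
    using h_pos unfolding cond_number_def by (intro frac_le) auto
  hence hl: "h / l \<le> \<kappa>" using cond by simp
  let ?D = "\<lambda>I. Determinant.det (principal_submatrix M I)"
  note bounds = principal_minor_bounds[OF M sym l(2) h(2) l_pos]
  \<comment> \<open>The minors grow from the empty determinant 1 by factors of at least
    \<open>l > 0\<close>.\<close>
  have D_pos: "0 < ?D I" if "I \<subseteq> {..<n}" for I
  proof -
    have "finite I" using that finite_subset by blast
    thus ?thesis using that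
    proof (induction I rule: finite_induct)
      case empty
      thus ?case using principal_submatrix_carrier[OF M, of "{}"] by simp
    next
      case (insert a F)
      hence "0 < ?D F" by simp
      thus ?case using bounds(1)[of a F] insert l_pos by (smt (verit) mult_pos_pos)
    qed
  qed
  have K': "K \<subseteq> {..<n}" using K by auto
  have step: "log b (?D (insert x K)) - log b (?D (insert y K)) \<le> log b \<kappa>"
    if "insert x K \<subseteq> {..<n}" "insert y K \<subseteq> {..<n}" "x \<notin> K" "y \<notin> K" for x y
  proof -
    have "?D (insert x K) / ?D (insert y K) \<le> (h * ?D K) / (l * ?D K)"
      using that bounds[of x K] bounds[of y K] D_pos K' h_pos l_pos
      by (intro frac_le) (auto intro: mult_nonneg_nonneg less_imp_le)
    also have "\<dots> = h / l" using D_pos[OF K'] by simp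
    also have "\<dots> \<le> \<kappa>" by (rule hl)
    finally have "?D (insert x K) / ?D (insert y K) \<le> \<kappa>" .
    hence "log b (?D (insert x K) / ?D (insert y K)) \<le> log b \<kappa>"
      using b D_pos that by (intro log_mono) auto
    thus ?thesis using D_pos that b by (simp add: log_divide_pos)
  qed
  show ?thesis
    using step[of i j] step[of j i] K by (simp add: log_det_def abs_le_iff)
qed

subsection \<open>Concentration for uniformly random subsets\<close>

text \<open>The uniform expectation as a plain finite sum, which makes double counting and
  reindexing direct.\<close>

definition mean :: "'a set \<Rightarrow> ('a \<Rightarrow> real) \<Rightarrow> real" where
  "mean A f = sum f A / real (card A)"

definition ksubsets :: "'a set \<Rightarrow> nat \<Rightarrow> 'a set set" where
  "ksubsets S k = {I. I \<subseteq> S \<and> card I = k}"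

lemma mean_eq_expectation:
  "finite A \<Longrightarrow> A \<noteq> {} \<Longrightarrow> mean A f = measure_pmf.expectation (pmf_of_set A) f"
  by (simp add: integral_pmf_of_set mean_def)

lemma mean_mono: "(\<And>x. x \<in> A \<Longrightarrow> f x \<le> g x) \<Longrightarrow> mean A f \<le> mean A g"
  by (simp add: mean_def divide_right_mono sum_mono)

lemma mean_cmult: "mean A (\<lambda>x. c * f x) = c * mean A f"
  by (simp add: mean_def sum_distrib_left)

lemma mean_uminus: "mean A (\<lambda>x. - f x) = - mean A f"
  by (simp add: mean_def sum_negf)

lemma mean_add: "mean A (\<lambda>x. f x + g x) = mean A f + mean A g"
  by (simp add: mean_def sum.distrib add_divide_distrib)

lemma mean_diff: "mean A (\<lambda>x. f x - g x) = mean A f - mean A g"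
  by (simp add: mean_def sum_subtractf diff_divide_distrib)

lemma mean_const: "finite A \<Longrightarrow> A \<noteq> {} \<Longrightarrow> mean A (\<lambda>x. c) = c"
  by (simp add: mean_def)

lemma mean_reindex: "bij_betw h A B \<Longrightarrow> mean B f = mean A (\<lambda>x. f (h x))"
  by (simp add: mean_def sum.reindex_bij_betw bij_betw_same_card)

lemma finite_ksubsets: "finite S \<Longrightarrow> finite (ksubsets S k)"
  by (simp add: ksubsets_def)

lemma card_ksubsets: "finite S \<Longrightarrow> card (ksubsets S k) = card S choose k"
  by (simp add: ksubsets_def n_subsets)

lemma ksubsets_nonempty: "finite S \<Longrightarrow> k \<le> card S \<Longrightarrow> ksubsets S k \<noteq> {}"
  using card_ksubsets[of S k] zero_less_binomial[of k "card S"] by fastforce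

text \<open>A uniform subset arises by drawing a uniform first element and then a uniform
  \<open>m\<close>-subset of the rest. Pairs \<open>(a, J)\<close> correspond to pairs
  \<open>(I, a)\<close> with \<open>a \<in> I\<close>, so each \<open>I\<close> is counted
  \<open>Suc m\<close> times; the normalisations agree by the absorption identity for binomial
  coefficients.\<close>

lemma mean_ksubsets_Suc:
  assumes "finite S" "Suc m \<le> card S"
  shows "mean (ksubsets S (Suc m)) F = mean S (\<lambda>a. mean (ksubsets (S - {a}) m) (\<lambda>J. F (insert a J)))"
proof -
  define N where "N = card S"
  have sum_eq: "(\<Sum>a\<in>S. \<Sum>J\<in>ksubsets (S - {a}) m. F (insert a J)) = real (Suc m) * sum F (ksubsets S (Suc m))"
  proof -
    have "(\<Sum>a\<in>S. \<Sum>J\<in>ksubsets (S - {a}) m. F (insert a J)) =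
          (\<Sum>(a,J)\<in>(SIGMA a:S. ksubsets (S - {a}) m). F (insert a J))"
      using assms by (intro sum.Sigma) (auto intro: finite_ksubsets)
    also have "\<dots> = (\<Sum>(I,a)\<in>(SIGMA I:ksubsets S (Suc m). I). F I)"
    proof (rule sum.reindex_bij_witness[where i = "\<lambda>(I,a). (a, I - {a})" and j = "\<lambda>(a,J). (insert a J, a)"],
        goal_cases)
      case (1 x)
      thus ?case by (auto simp: ksubsets_def)
    next
      case (2 x)
      obtain a J where x: "x = (a, J)" "a \<in> S" "J \<subseteq> S - {a}" "card J = m"
        using 2 by (auto simp: ksubsets_def)
      moreover have "finite J" "a \<notin> J" using x assms(1) finite_subset by blast+
      ultimately show ?case by (auto simp: ksubsets_def)
    next
      case (3 x)
      thus ?case by (auto simp: ksubsets_def)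
    next
      case (4 x)
      obtain a I where x: "x = (I, a)" "a \<in> I" "I \<subseteq> S" "card I = Suc m"
        using 4 by (auto simp: ksubsets_def)
      moreover have "finite I" using x assms(1) finite_subset by blast
      ultimately show ?case by (auto simp: ksubsets_def)
    next
      case (5 x)
      thus ?case by auto
    qed
    also have "\<dots> = (\<Sum>I\<in>ksubsets S (Suc m). \<Sum>a\<in>I. F I)"
      using assms finite_subset[of _ S]
      by (intro sum.Sigma[symmetric]) (auto intro: finite_ksubsets simp: ksubsets_def)
    also have "\<dots> = (\<Sum>I\<in>ksubsets S (Suc m). real (Suc m) * F I)"
      by (intro sum.cong refl) (auto simp: ksubsets_def)
    finally show ?thesis by (simp only: sum_distrib_left)
  qed
  have card: "card (ksubsets (S - {a}) m) = (N - 1) choose m" if "a \<in> S" for a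
    using assms that by (simp add: card_ksubsets N_def)
  have "mean S (\<lambda>a. mean (ksubsets (S - {a}) m) (\<lambda>J. F (insert a J))) =
        (\<Sum>a\<in>S. \<Sum>J\<in>ksubsets (S - {a}) m. F (insert a J)) / real ((N - 1) choose m) / real N"
    unfolding mean_def N_def[symmetric] by (simp add: card sum_divide_distrib)
  also have "\<dots> = real (Suc m) * sum F (ksubsets S (Suc m)) / (real N * real ((N - 1) choose m))"
    by (simp add: sum_eq)
  also have "real N * real ((N - 1) choose m) = real (Suc m) * real (N choose Suc m)"
    using Suc_times_binomial[of m "N - 1"] assms(2)
    by (metis N_def Suc_diff_1 Suc_le_lessD less_nat_zero_code not_gr_zero of_nat_mult)
  also have "real (Suc m) * sum F (ksubsets S (Suc m)) / \<dots> = sum F (ksubsets S (Suc m)) / real (N choose Suc m)"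
    by (simp del: of_nat_Suc)
  also have "\<dots> = mean (ksubsets S (Suc m)) F"
    using assms by (simp add: mean_def card_ksubsets N_def)
  finally show ?thesis ..
qed

section \<open>Moment generating functions under exchange of one element\<close>

text \<open>For \<open>s > 0\<close> this is Hoeffding's lemma on the interval from the minimum to
  the maximum of \<open>g\<close>. Both are attained, so its length is at most \<open>L\<close>.
  Negative \<open>s\<close> is handled by reflecting \<open>g\<close>.\<close>

lemma Hoeffdings_lemma_mean:
  assumes S: "finite S" "S \<noteq> {}" and L: "\<And>a c. a \<in> S \<Longrightarrow> c \<in> S \<Longrightarrow> \<bar>g a - g c\<bar> \<le> L"
  shows "mean S (\<lambda>a. exp (s * g a)) \<le> exp (s * mean S g + s\<^sup>2 * L\<^sup>2 / 8)"
proof -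
  have pos: "mean S (\<lambda>a. exp (s * g a)) \<le> exp (s * mean S g + s\<^sup>2 * L\<^sup>2 / 8)"
    if s: "s > 0" and L: "\<And>a c. a \<in> S \<Longrightarrow> c \<in> S \<Longrightarrow> \<bar>g a - g c\<bar> \<le> L" for s and g :: "'a \<Rightarrow> real"
  proof -
    let ?P = "measure_pmf (pmf_of_set S)"
    interpret h: interval_bounded_random_variable ?P g "Min (g ` S)" "Max (g ` S)"
    proof
      show "AE x in ?P. g x \<in> {Min (g ` S)..Max (g ` S)}"
        using S by (auto simp: AE_measure_pmf_iff)
    qed auto
    have "Max (g ` S) \<in> g ` S" "Min (g ` S) \<in> g ` S" using S by auto
    then obtain u v where uv: "u \<in> S" "v \<in> S" "Max (g ` S) = g u" "Min (g ` S) = g v" by auto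
    have "Min (g ` S) \<le> g u" using S uv(1) by simp
    hence rng: "0 \<le> Max (g ` S) - Min (g ` S)" "Max (g ` S) - Min (g ` S) \<le> L"
      using L[OF uv(1,2)] by (simp_all add: uv abs_le_iff)
    have mu: "measure_pmf.expectation (pmf_of_set S) g = mean S g"
      using S by (simp add: mean_eq_expectation)
    have "ennreal (mean S (\<lambda>a. exp (s * (g a - mean S g)))) =
          (\<integral>\<^sup>+x. ennreal (exp (s * (g x - mean S g))) \<partial>?P)"
      unfolding mean_eq_expectation[OF S, of "\<lambda>a. exp (s * (g a - mean S g))"]
      by (intro nn_integral_eq_integral[symmetric] integrable_measure_pmf_finite) (use S in auto)
    also have "\<dots> \<le> ennreal (exp (s\<^sup>2 * (Max (g ` S) - Min (g ` S))\<^sup>2 / 8))"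
      using h.Hoeffdings_lemma_nn_integral[OF s] by (simp add: mu)
    finally have "mean S (\<lambda>a. exp (s * (g a - mean S g))) \<le> exp (s\<^sup>2 * (Max (g ` S) - Min (g ` S))\<^sup>2 / 8)"
      by (simp add: ennreal_le_iff)
    also have "\<dots> \<le> exp (s\<^sup>2 * L\<^sup>2 / 8)"
      using rng by (auto intro!: mult_left_mono power_mono)
    finally have "exp (s * mean S g) * mean S (\<lambda>a. exp (s * (g a - mean S g)))
                   \<le> exp (s * mean S g) * exp (s\<^sup>2 * L\<^sup>2 / 8)" by simp
    thus ?thesis
      by (simp flip: mean_cmult exp_add add: algebra_simps)
  qed
  consider "s > 0" | "s = 0" | "- s > 0" by linarith
  thus ?thesis
  proof cases
    case 2
    thus ?thesis using S by (simp add: mean_const)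
  next
    case 3
    thus ?thesis using pos[of "-s" "\<lambda>a. - g a"] L by (simp add: mean_uminus abs_minus_commute)
  qed (use pos L in blast)
qed

text \<open>
  Reveal the elements of the random set one at a time. Transposing \<open>a\<close> and \<open>c\<close> couples the
  conditional laws given that the first element is \<open>a\<close> or \<open>c\<close>, so every step of the resulting
  martingale has range at most \<open>L\<close>.
\<close>
lemma ksubsets_mgf:
  fixes f :: "'a set \<Rightarrow> real"
  assumes "finite S" "k \<le> card S"
    and "\<And>K i j. K \<subseteq> S \<Longrightarrow> Suc (card K) = k \<Longrightarrow> i \<in> S - K \<Longrightarrow> j \<in> S - K \<Longrightarrow>
           \<bar>f (insert i K) - f (insert j K)\<bar> \<le> L"
  shows "mean (ksubsets S k) (\<lambda>I. exp (s * f I))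
           \<le> exp (s * mean (ksubsets S k) f + s\<^sup>2 * (real k * L\<^sup>2) / 8)"
  using assms
proof (induction k arbitrary: S f)
  case 0
  have "ksubsets S 0 = {{}}" using 0 finite_subset[of _ S] by (auto simp: ksubsets_def)
  thus ?case by (simp add: mean_def)
next
  case (Suc m)
  note fin = \<open>finite S\<close>
  have S_ne: "S \<noteq> {}" using Suc.prems by auto
  \<comment> \<open>\<open>g a\<close> is the conditional mean of \<open>f\<close> given that
    \<open>a\<close> is drawn first.\<close>
  define g where "g = (\<lambda>a. mean (ksubsets (S - {a}) m) (\<lambda>J. f (insert a J)))"
  have inner: "mean (ksubsets (S - {a}) m) (\<lambda>J. exp (s * f (insert a J)))
                 \<le> exp (s * g a + s\<^sup>2 * (real m * L\<^sup>2) / 8)" if a: "a \<in> S" for a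
    unfolding g_def
  proof (rule Suc.IH)
    show "finite (S - {a})" "m \<le> card (S - {a})" using fin a Suc.prems by auto
    fix K i j
    assume K: "K \<subseteq> S - {a}" "Suc (card K) = m" "i \<in> S - {a} - K" "j \<in> S - {a} - K"
    have "finite K" using K fin by (meson finite_Diff finite_subset)
    hence "\<bar>f (insert i (insert a K)) - f (insert j (insert a K))\<bar> \<le> L"
      using K a by (intro Suc.prems(3)) (auto simp: card_insert_if)
    thus "\<bar>f (insert a (insert i K)) - f (insert a (insert j K))\<bar> \<le> L"
      by (simp add: insert_commute)
  qed
  have g_le: "g a - g c \<le> L" if ac: "a \<in> S" "c \<in> S" for a c
  proof (cases "a = c")
    case True
    \<comment> \<open>Nonnegativity of \<open>L\<close> comes from the exchange bound with equal
      elements, once some \<open>K\<close> of size \<open>m\<close> is available.\<close>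
    have "0 \<le> L"
    proof -
      have "m \<le> card (S - {a})" using fin ac Suc.prems by simp
      then obtain K where "K \<subseteq> S - {a}" "card K = m"
        by (rule obtain_subset_with_card_n)
      hence "\<bar>f (insert a K) - f (insert a K)\<bar> \<le> L"
        using ac by (intro Suc.prems(3)) auto
      thus ?thesis by simp
    qed
    thus ?thesis using True by simp
  next
    case False
    \<comment> \<open>\<open>h\<close> is the transposition of \<open>a\<close> and
      \<open>c\<close>, acting on sets without \<open>a\<close>. If \<open>c \<in> J\<close>, then
      \<open>insert c (h J) = insert a J\<close>; otherwise the two sets differ by one
      exchange.\<close>
    define h where "h = (\<lambda>J. if c \<in> J then insert a (J - {c}) else J)"
    have card_swap: "card (insert y (J - {x})) = m" if "J \<subseteq> S - {y}" "card J = m" "x \<in> J" for x y J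
    proof -
      have J: "finite J" "y \<notin> J - {x}" using that fin finite_subset by blast+
      hence "card (insert y (J - {x})) = Suc (card (J - {x}))" by (intro card_insert_disjoint finite_Diff)
      also have "\<dots> = card J" using J that by (intro card_Suc_Diff1)
      finally show ?thesis using that by simp
    qed
    have bij: "bij_betw h (ksubsets (S - {a}) m) (ksubsets (S - {c}) m)"
    proof (rule bij_betw_byWitness[where f' = "\<lambda>J. if a \<in> J then insert c (J - {a}) else J"])
      show "h ` ksubsets (S - {a}) m \<subseteq> ksubsets (S - {c}) m"
        using ac False card_swap[of _ a c] by (auto simp: h_def ksubsets_def)
      show "(\<lambda>J. if a \<in> J then insert c (J - {a}) else J) ` ksubsets (S - {c}) m \<subseteq> ksubsets (S - {a}) m"
        using ac False card_swap[of _ c a] by (auto simp: ksubsets_def)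
    qed (use False in \<open>auto simp: h_def ksubsets_def\<close>)
    have "g a - g c = mean (ksubsets (S - {a}) m) (\<lambda>J. f (insert a J) - f (insert c (h J)))"
      unfolding g_def mean_diff mean_reindex[OF bij] ..
    also have "\<dots> \<le> mean (ksubsets (S - {a}) m) (\<lambda>J. L)"
    proof (rule mean_mono)
      fix J assume "J \<in> ksubsets (S - {a}) m"
      hence J: "J \<subseteq> S - {a}" "card J = m" by (auto simp: ksubsets_def)
      have "\<bar>f (insert a J) - f (insert c J)\<bar> \<le> L" if "c \<notin> J"
        using J that ac by (intro Suc.prems(3)) auto
      moreover have "insert c (insert a (J - {c})) = insert a J" if "c \<in> J" using that by auto
      moreover have "0 \<le> L"
      proof -
        have "\<bar>f (insert a J) - f (insert a J)\<bar> \<le> L"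
          using J ac by (intro Suc.prems(3)) auto
        thus ?thesis by simp
      qed
      ultimately show "f (insert a J) - f (insert c (h J)) \<le> L"
        by (auto simp: h_def abs_le_iff)
    qed
    also have "\<dots> = L"
      using fin ac Suc.prems by (intro mean_const finite_ksubsets ksubsets_nonempty) auto
    finally show ?thesis .
  qed
  \<comment> \<open>The inner means contribute \<open>m * L^2 / 8\<close> to the exponent, and
    Hoeffding's lemma for \<open>g\<close> adds the last \<open>L^2 / 8\<close>, each times
    \<open>s^2\<close>.\<close>
  have "mean (ksubsets S (Suc m)) (\<lambda>I. exp (s * f I)) =
        mean S (\<lambda>a. mean (ksubsets (S - {a}) m) (\<lambda>J. exp (s * f (insert a J))))"
    by (rule mean_ksubsets_Suc) fact+
  also have "\<dots> \<le> mean S (\<lambda>a. exp (s\<^sup>2 * (real m * L\<^sup>2) / 8) * exp (s * g a))"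
    using inner by (intro mean_mono) (simp add: add.commute flip: exp_add)
  also have "\<dots> \<le> exp (s\<^sup>2 * (real m * L\<^sup>2) / 8) * exp (s * mean S g + s\<^sup>2 * L\<^sup>2 / 8)"
    unfolding mean_cmult using fin S_ne g_le
    by (intro mult_left_mono Hoeffdings_lemma_mean) (auto simp: abs_le_iff)
  also have "\<dots> = exp (s * mean S g + s\<^sup>2 * (real (Suc m) * L\<^sup>2) / 8)"
    by (simp add: field_simps flip: exp_add)
  also have "mean S g = mean (ksubsets S (Suc m)) f"
    unfolding g_def by (rule mean_ksubsets_Suc[symmetric]) fact+
  finally show ?case .
qed

text \<open>
  Passing to complements exchanges \<open>k\<close> and \<open>n - k\<close>, and the smaller of the two is at most
  \<open>2 k (n - k) / n\<close>.
\<close>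
lemma ksubsets_mgf_symmetric:
  fixes f :: "'a set \<Rightarrow> real"
  assumes fin: "finite S" and k: "k \<le> card S"
    and L: "\<And>K i j. K \<subseteq> S \<Longrightarrow> Suc (card K) = k \<Longrightarrow> i \<in> S - K \<Longrightarrow> j \<in> S - K \<Longrightarrow>
           \<bar>f (insert i K) - f (insert j K)\<bar> \<le> L"
    and n: "card S = n" "0 < n"
  shows "mean (ksubsets S k) (\<lambda>I. exp (s * f I))
           \<le> exp (s * mean (ksubsets S k) f + s\<^sup>2 * (real k * (real n - real k) / real n * L\<^sup>2) / 4)"
proof (cases "2 * k \<le> n")
  case True
  have "real k * real n \<le> real k * (2 * (real n - real k))"
    using True by (intro mult_left_mono) auto
  hence "real k \<le> 2 * (real k * (real n - real k) / real n)"
    using n by (simp add: field_simps)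
  hence "s\<^sup>2 * (real k * L\<^sup>2) / 8 \<le> s\<^sup>2 * (2 * (real k * (real n - real k) / real n) * L\<^sup>2) / 8"
    by (intro divide_right_mono mult_left_mono mult_right_mono) auto
  hence le: "exp (c + s\<^sup>2 * (real k * L\<^sup>2) / 8)
           \<le> exp (c + s\<^sup>2 * (real k * (real n - real k) / real n * L\<^sup>2) / 4)" for c
    by simp
  have "mean (ksubsets S k) (\<lambda>I. exp (s * f I))
          \<le> exp (s * mean (ksubsets S k) f + s\<^sup>2 * (real k * L\<^sup>2) / 8)"
    by (rule ksubsets_mgf[OF fin k]) (rule L)
  thus ?thesis using le by (rule order_trans)
next
  case False
  define m where "m = n - k"
  have m: "m \<le> n" "real m = real n - real k" using k n by (auto simp: m_def)
  have bij: "bij_betw (\<lambda>J. S - J) (ksubsets S m) (ksubsets S k)"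
  proof (rule bij_betw_byWitness[where f' = "\<lambda>J. S - J"])
    show "(\<lambda>J. S - J) ` ksubsets S m \<subseteq> ksubsets S k"
      using fin k n by (auto simp: ksubsets_def m_def card_Diff_subset finite_subset)
    show "(\<lambda>J. S - J) ` ksubsets S k \<subseteq> ksubsets S m"
      using fin k n by (auto simp: ksubsets_def m_def card_Diff_subset finite_subset)
  qed (auto simp: ksubsets_def)
  have mgf: "mean (ksubsets S m) (\<lambda>J. exp (s * f (S - J)))
           \<le> exp (s * mean (ksubsets S m) (\<lambda>J. f (S - J)) + s\<^sup>2 * (real m * L\<^sup>2) / 8)"
  proof (rule ksubsets_mgf[OF fin])
    show "m \<le> card S" using m n by simp
    fix K i j
    assume K: "K \<subseteq> S" "Suc (card K) = m" "i \<in> S - K" "j \<in> S - K"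
    \<comment> \<open>The complements of \<open>insert i K\<close> and \<open>insert j K\<close> are
      \<open>insert j R\<close> and \<open>insert i R\<close>, so they too differ by one exchange
      over a set of size \<open>k - 1\<close>.\<close>
    define R where "R = S - K - {i, j}"
    have "finite K" using K fin finite_subset by blast
    show "\<bar>f (S - insert i K) - f (S - insert j K)\<bar> \<le> L"
    proof (cases "i = j")
      case True
      \<comment> \<open>For \<open>i = j\<close> only \<open>0 \<le> L\<close> is at stake, and any
        set of size \<open>k - 1\<close> provides it.\<close>
      have "k > 0" using False n by simp
      have "k - 1 \<le> card S" using k by simp
      then obtain R where R: "R \<subseteq> S" "card R = k - 1"
        by (rule obtain_subset_with_card_n)
      moreover have "R \<noteq> S" using R n \<open>k > 0\<close> k by auto
      ultimately obtain x where "x \<in> S - R" by blast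
      hence "\<bar>f (insert x R) - f (insert x R)\<bar> \<le> L"
        using R \<open>k > 0\<close> by (intro L) auto
      thus ?thesis using True by simp
    next
      case False
      have "card R = card S - card (insert i (insert j K))"
        unfolding R_def using K \<open>finite K\<close>
        by (subst card_Diff_subset[symmetric]) (auto intro!: arg_cong[where f = card])
      also have "card (insert i (insert j K)) = Suc m"
        using K False \<open>finite K\<close> by simp
      finally have "card R = n - Suc m" using n by simp
      moreover have "Suc m \<le> n"
        using card_mono[OF fin, of "insert i (insert j K)"] K False \<open>finite K\<close> n by simp
      ultimately have "Suc (card R) = k" using k n unfolding m_def by auto
      hence "\<bar>f (insert j R) - f (insert i R)\<bar> \<le> L"
        using K by (intro L) (auto simp: R_def)
      moreover have "insert j R = S - insert i K" "insert i R = S - insert j K"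
        using K False by (auto simp: R_def)
      ultimately show ?thesis by simp
    qed
  qed
  have "real m * real n \<le> real m * (2 * real k)"
    using False by (intro mult_left_mono) auto
  hence "real m \<le> 2 * (real k * (real n - real k) / real n)"
    using n by (simp add: field_simps m(2))
  hence "s\<^sup>2 * (real m * L\<^sup>2) / 8 \<le> s\<^sup>2 * (2 * (real k * (real n - real k) / real n) * L\<^sup>2) / 8"
    by (intro divide_right_mono mult_left_mono mult_right_mono) auto
  hence le: "exp (c + s\<^sup>2 * (real m * L\<^sup>2) / 8)
           \<le> exp (c + s\<^sup>2 * (real k * (real n - real k) / real n * L\<^sup>2) / 4)" for c
    by simp
  show ?thesis
    unfolding mean_reindex[OF bij] by (rule order_trans[OF mgf le])
qed

section \<open>Tail and variance from a subgaussian moment generating function\<close>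

lemma subgaussian_tail:
  assumes A: "finite A" "A \<noteq> {}" and c: "0 < c" and r: "0 \<le> r"
    and mgf: "\<And>s. mean A (\<lambda>x. exp (s * X x)) \<le> exp (s\<^sup>2 * c / 4)"
  shows "real (card {x \<in> A. r \<le> \<bar>X x\<bar>}) / real (card A) \<le> 2 * exp (- (r\<^sup>2 / c))"
proof -
  have one_side: "mean A (\<lambda>x. of_bool (r \<le> Y x)) \<le> exp (- (r\<^sup>2 / c))"
    if mgf: "\<And>s. mean A (\<lambda>x. exp (s * Y x)) \<le> exp (s\<^sup>2 * c / 4)" for Y
  proof -
    \<comment> \<open>Chernoff's method: this \<open>s\<close> minimises
      \<open>- s * r + s^2 * c / 4\<close>, with value \<open>- r^2 / c\<close>.\<close>
    define s where "s = 2 * r / c"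
    have s: "s \<ge> 0" using c r by (simp add: s_def)
    have "mean A (\<lambda>x. of_bool (r \<le> Y x)) \<le> mean A (\<lambda>x. exp (- (s * r)) * exp (s * Y x))"
    proof (rule mean_mono)
      fix x
      show "of_bool (r \<le> Y x) \<le> exp (- (s * r)) * exp (s * Y x)"
        using s mult_left_mono[of r "Y x" s] by (simp flip: exp_add)
    qed
    also have "\<dots> \<le> exp (- (s * r)) * exp (s\<^sup>2 * c / 4)"
      unfolding mean_cmult using mgf by (intro mult_left_mono) auto
    also have "\<dots> = exp (- (r\<^sup>2 / c))"
      using c by (simp add: s_def field_simps power2_eq_square flip: exp_add)
    finally show ?thesis .
  qed
  have "real (card {x \<in> A. r \<le> \<bar>X x\<bar>}) / real (card A) = mean A (\<lambda>x. of_bool (r \<le> \<bar>X x\<bar>))"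
    using A by (simp add: mean_def Int_def)
  also have "\<dots> \<le> mean A (\<lambda>x. of_bool (r \<le> X x) + of_bool (r \<le> - X x))"
    by (intro mean_mono) auto
  also have "\<dots> \<le> exp (- (r\<^sup>2 / c)) + exp (- (r\<^sup>2 / c))"
    unfolding mean_add using mgf[of "- s" for s] 
    by (intro add_mono one_side mgf) auto
  finally show ?thesis by simp
qed

text \<open>Since \<open>exp x + exp (- x) - 2\<close> is the square of
  \<open>exp (x/2) - exp (- x/2)\<close>, the claim reduces to \<open>u \<le> sinh u\<close> for
  \<open>u \<ge> 0\<close>. There \<open>q = 1 + u + u^2/2 \<le> exp u\<close> and
  \<open>q^2 - 2 * u * q - 1 = u^4 / 4\<close> give \<open>2 * u \<le> q - 1/q\<close>.\<close>

lemma exp_add_exp_minus_ge: "2 + x\<^sup>2 \<le> exp x + exp (- x)" for x :: real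
proof -
  have *: "2 * u \<le> exp u - exp (- u)" if u: "u \<ge> 0" for u :: real
  proof -
    define q where "q = 1 + u + u\<^sup>2 / 2"
    have q: "q > 0" "q \<le> exp u"
      using u exp_lower_Taylor_quadratic[OF u] by (auto simp: q_def add_pos_nonneg)
    have "q\<^sup>2 - 2 * u * q - 1 = (u\<^sup>2)\<^sup>2 / 4"
      unfolding q_def by (simp add: power2_eq_square field_simps)
    hence "0 \<le> q\<^sup>2 - 2 * u * q - 1" by (metis zero_le_power2 divide_nonneg_pos zero_less_numeral)
    hence "2 * u \<le> q - 1 / q"
      using q by (simp add: field_simps power2_eq_square)
    also have "\<dots> \<le> exp u - exp (- u)"
    proof -
      have "1 / exp u \<le> 1 / q" using q by (intro divide_left_mono mult_pos_pos) auto
      thus ?thesis using q(2) by (simp add: exp_minus inverse_eq_divide)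
    qed
    finally show ?thesis .
  qed
  have "\<bar>x\<bar> \<le> exp (\<bar>x\<bar> / 2) - exp (- (\<bar>x\<bar> / 2))" using *[of "\<bar>x\<bar> / 2"] by simp
  hence "\<bar>x\<bar>\<^sup>2 \<le> (exp (\<bar>x\<bar> / 2) - exp (- (\<bar>x\<bar> / 2)))\<^sup>2" by (intro power_mono) auto
  also have "\<dots> = exp \<bar>x\<bar> + exp (- \<bar>x\<bar>) - 2"
  proof -
    define v w where "v = exp (\<bar>x\<bar> / 2)" and "w = exp (- (\<bar>x\<bar> / 2))"
    have "v * v = exp \<bar>x\<bar>" "w * w = exp (- \<bar>x\<bar>)" "v * w = 1"
      by (simp_all add: v_def w_def flip: exp_add)
    thus ?thesis by (simp add: v_def[symmetric] w_def[symmetric] power2_eq_square algebra_simps)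
  qed
  also have "\<dots> = exp x + exp (- x) - 2" by (simp add: abs_if)
  finally show ?thesis by simp
qed

text \<open>The lower bound \<open>2 + (s * X)^2\<close> for
  \<open>exp (s * X) + exp (- s * X)\<close> is averaged with a suitable \<open>s\<close>. Working
  with \<open>d > c\<close> and letting \<open>d\<close> tend to \<open>c\<close> covers
  \<open>c = 0\<close>.\<close>

lemma subgaussian_variance:
  assumes A: "finite A" "A \<noteq> {}" and c: "0 \<le> c"
    and mgf: "\<And>s. mean A (\<lambda>x. exp (s * X x)) \<le> exp (s\<^sup>2 * c / 4)"
  shows "mean A (\<lambda>x. (X x)\<^sup>2) \<le> c"
proof (rule dense_ge)
  fix d assume "c < d"
  hence d: "0 < d" "c \<le> d" using c by auto
  \<comment> \<open>Then \<open>s^2 * c / 4 \<le> 1\<close>, so each exponential mean is at most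
    \<open>exp 1 \<le> 3\<close>, and \<open>6 - 2 = 4 = s^2 * d\<close> closes the
    estimate.\<close>
  define s where "s = 2 / sqrt d"
  have s2: "s\<^sup>2 = 4 / d" using d by (simp add: s_def power_divide)
  have e: "exp (t\<^sup>2 * c / 4) \<le> 3" if "t\<^sup>2 = 4 / d" for t
  proof -
    have "exp (t\<^sup>2 * c / 4) \<le> exp 1" using d that by simp
    thus ?thesis using exp_le by linarith
  qed
  have "2 + s\<^sup>2 * mean A (\<lambda>x. (X x)\<^sup>2) = mean A (\<lambda>x. 2 + (s * X x)\<^sup>2)"
    using A by (simp add: mean_add mean_const mean_cmult power_mult_distrib)
  also have "\<dots> \<le> mean A (\<lambda>x. exp (s * X x) + exp (- (s * X x)))"
    by (intro mean_mono exp_add_exp_minus_ge)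
  also have "\<dots> = mean A (\<lambda>x. exp (s * X x)) + mean A (\<lambda>x. exp (- s * X x))"
    by (simp add: mean_add)
  also have "\<dots> \<le> 3 + 3"
    using order_trans[OF mgf[of s] e[of s]] order_trans[OF mgf[of "- s"] e[of "- s"]] s2
    by (intro add_mono) auto
  finally have "s\<^sup>2 * mean A (\<lambda>x. (X x)\<^sup>2) \<le> 4" by simp
  thus "mean A (\<lambda>x. (X x)\<^sup>2) \<le> d" using d by (simp add: s2 field_simps)
qed

text \<open>This is where the constant 3 comes from: \<open>2 exp (1/4) < 3\<close>.\<close>
lemma two_exp_neg_square_le: "2 * exp (- (t\<^sup>2)) \<le> 3 * exp (- t)" for t :: real
proof -
  have "0 \<le> (t - 1/2)\<^sup>2" by simp
  hence "- (t\<^sup>2) \<le> - t + 1 / 4" by (simp add: power2_eq_square algebra_simps)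
  hence "exp (- (t\<^sup>2)) \<le> exp (- t + 1 / 4)" by simp
  also have "\<dots> = exp (- t) * exp (1 / 4)" by (simp flip: exp_add)
  also have "exp (1 / 4 :: real) \<le> 3 / 2"
    using exp_bound[of "1/4"] by (simp add: power2_eq_square)
  finally show ?thesis by simp
qed

subsection \<open>Random principal submatrices\<close>

theorem theorem1:
  fixes M :: "real mat" and n k :: nat and b \<kappa> :: real
  assumes "b > 1"
    and "pos_def_mat n M"
    and "cond_number M \<le> \<kappa>"
    and "1 \<le> k" and "k \<le> n"
  shows
    "(k < n \<and> \<kappa> > 1 \<longrightarrow>
       (\<forall>r\<ge>0.
          measure_pmf.prob (random_principal_submatrix k M)
            {A. \<bar>log_det b A -
                 measure_pmf.expectation (random_principal_submatrix k M) (log_det b)\<bar> \<ge> r}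
          \<le> 3 * exp (- (r / log b \<kappa>) * sqrt (real n / (real k * (real n - real k))))))
     \<and> measure_pmf.variance (random_principal_submatrix k M) (log_det b)
         \<le> 6 * (real k * (real n - real k) / real n) * (log b \<kappa>)\<^sup>2"
proof -
  define S where "S = {..<n}"
  define A where "A = ksubsets S k"
  define X where "X = (\<lambda>I. log_det b (principal_submatrix M I))"
  define \<mu> where "\<mu> = mean A X"
  define L where "L = log b \<kappa>"
  define N where "N = real k * (real n - real k) / real n"
  define P where "P = random_principal_submatrix k M"
  have n: "0 < n" using assms by simp
  have S: "finite S" "card S = n" by (simp_all add: S_def)
  have A: "finite A" "A \<noteq> {}"
    unfolding A_def using S assms(5) by (simp_all add: finite_ksubsets ksubsets_nonempty)
  have M: "M \<in> carrier_mat n n" using assms by (simp add: pos_def_mat_def)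
  have P: "P = map_pmf (principal_submatrix M) (pmf_of_set A)"
    using M by (simp add: P_def random_principal_submatrix_def A_def ksubsets_def S_def)
  \<comment> \<open>Different index sets may give the same submatrix, so averages are taken over
    index sets, where the law is uniform.\<close>
  have expect: "measure_pmf.expectation P g = mean A (\<lambda>I. g (principal_submatrix M I))" for g
    by (simp add: P mean_eq_expectation[OF A])
  have exp_X: "measure_pmf.expectation P (log_det b) = \<mu>"
    by (simp add: expect \<mu>_def X_def)
  have N: "0 \<le> N" using assms by (simp add: N_def)
  have mgf: "mean A (\<lambda>I. exp (s * (X I - \<mu>))) \<le> exp (s\<^sup>2 * (N * L\<^sup>2) / 4)" for s
  proof -
    have "mean A (\<lambda>I. exp (s * X I)) \<le> exp (s * \<mu> + s\<^sup>2 * (N * L\<^sup>2) / 4)"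
      unfolding A_def \<mu>_def N_def
    proof (rule ksubsets_mgf_symmetric)
      show "finite S" "k \<le> card S" "card S = n" "0 < n" using S n assms by simp_all
      show "\<bar>X (insert i K) - X (insert j K)\<bar> \<le> L"
        if "K \<subseteq> S" "i \<in> S - K" "j \<in> S - K" for K i j
        unfolding X_def L_def using that
        by (intro log_det_swap_le[OF assms(1-3)]) (auto simp: S_def)
    qed
    hence "exp (- (s * \<mu>)) * mean A (\<lambda>I. exp (s * X I))
             \<le> exp (- (s * \<mu>)) * exp (s * \<mu> + s\<^sup>2 * (N * L\<^sup>2) / 4)"
      by (intro mult_left_mono) auto
    thus ?thesis by (simp add: right_diff_distrib flip: mean_cmult exp_add)
  qed
  have tail: "measure_pmf.prob P {B. r \<le> \<bar>log_det b B - \<mu>\<bar>}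
                \<le> 3 * exp (- (r / L) * sqrt (real n / (real k * (real n - real k))))"
    if kn: "k < n" and \<kappa>: "1 < \<kappa>" and r: "0 \<le> r" for r
  proof -
    have L: "0 < L" using \<kappa> assms(1) by (simp add: L_def)
    have N: "0 < N" using kn assms(4) by (simp add: N_def)
    \<comment> \<open>\<open>t\<close> is the exponent in the claim, and its square is the
      subgaussian exponent \<open>r^2 / (N * L^2)\<close>.\<close>
    define t where "t = r / L * sqrt (1 / N)"
    have t2: "t\<^sup>2 = r\<^sup>2 / (N * L\<^sup>2)"
      using N by (simp add: t_def power_mult_distrib power_divide real_sqrt_divide)
    have "measure_pmf.prob P {B. r \<le> \<bar>log_det b B - \<mu>\<bar>} =
          real (card {I \<in> A. r \<le> \<bar>X I - \<mu>\<bar>}) / real (card A)"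
      using A by (simp add: P measure_pmf_of_set X_def Int_def)
    also have "\<dots> \<le> 2 * exp (- (r\<^sup>2 / (N * L\<^sup>2)))"
      using A N L r mgf by (intro subgaussian_tail) auto
    also have "\<dots> \<le> 3 * exp (- t)"
      using two_exp_neg_square_le[of t] by (simp add: t2)
    also have "- t = - (r / L) * sqrt (real n / (real k * (real n - real k)))"
      by (simp add: t_def N_def)
    finally show ?thesis .
  qed
  have "measure_pmf.variance P (log_det b) = mean A (\<lambda>I. (X I - \<mu>)\<^sup>2)"
    unfolding exp_X by (simp add: expect X_def)
  also have "\<dots> \<le> N * L\<^sup>2"
    using A N mgf by (intro subgaussian_variance) auto
  \<comment> \<open>The subgaussian estimate gives the constant 1, which is weakened to 6
    here.\<close>
  also have "\<dots> \<le> 6 * N * L\<^sup>2"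
    using N by (simp add: mult_right_mono)
  finally show ?thesis
    using tail by (simp add: exp_X N_def L_def flip: P_def)
qed

end
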